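(* Let $A$ be a bigraded $K$-algebra satisfying conditions (i)--(iii) of the context, with fixed homogeneous generators $f_1,\ldots,f_m$ of $A_1$ and the corresponding presentation $\varphi:T=K[x_1,\ldots,x_n,y_1,\ldots,y_m]\to A$ with kernel $J$. Let $<'$ be a monomial order on $K[y_1,\ldots,y_m]$, $<_x$ a monomial order on $K[x_1,\ldots,x_n]$, and let $<$ be the product order on $T$ defined from them in the context. Suppose that $J$ satisfies the $x$-condition with respect to $<$. Then for all $k\geq 1$ the $S$-module $A_k$ has linear quotients.
   Context: Let $K$ be a field and $A=\bigoplus_{i,j}A_{(i,j)}$ a (commutative) bigraded $K$-algebra with $A_{(0,0)}=K$. Set $A_j=\bigoplus_iA_{(i,j)}$; then $A=\bigoplus_jA_j$ is a graded $A_0$-algebra, and each $A_j$ is a graded $A_0$-module with $(A_j)_i=A_{(i,j)}$. It is required that: (i) $A_0$ is the polynomial ring $S=K[x_1,\ldots,x_n]$ with the standard grading; (ii) $A_1$ is a finitely generated $S$-module and $(A_1)_i=0$ for $i<0$; (iii) $A=S[A_1]$, i.e. $A_i=A_1^i$ for all $i\ge1$. Fix homogeneous generators $f_1,\ldots,f_m$ of the $S$-module $A_1$ with $\deg f_i=d_i$. Let $T=K[x_1,\ldots,x_n,y_1,\ldots,y_m]$ be bigraded by $\deg x_i=(1,0)$, $\deg y_j=(d_j,1)$, and let $\varphi:T\to A$ be the surjective bigraded $K$-algebra homomorphism with $\varphi(x_i)=x_i$, $\varphi(y_j)=f_j$; $J=\operatorname{Ker}(\varphi)$. The product order $<$ on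 $T$ determined by $<'$ and $<_x$: for monomials $u,u'\in K[x_1,\ldots,x_n]$ and $w,w'\in K[y_1,\ldots,y_m]$, $uw<u'w'$ iff $w<'w'$, or $w=w'$ and $u<_xu'$. $J$ satisfies the $x$-condition with respect to a monomial order $<$ on $T$ if every minimal monomial generator of $\operatorname{in}_<(J)$ has the form $vw$ with $v\in S$ a monomial of degree $\le1$ and $w\in K[y_1,\ldots,y_m]$ a monomial. An $S$-module $M$ has linear quotients if it has a system of generators $g_1,\ldots,g_r$ such that for each $1\le j\le r$ the ideal $(g_1,\ldots,g_{j-1}):g_j=\{h\in S: hg_j\in(g_1,\ldots,g_{j-1})\}$ is either $S$ or generated by linear forms (the zero ideal is allowed). *)

theory Defs
  imports Complex_Main "HOL-Library.Poly_Mapping" "HOL-Library.Product_Plus"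
begin

section \<open>Polynomials and monomial orders\<close>

text \<open>
  A monomial in variables indexed by a finite type is its exponent vector, and a polynomial
  is a finitely supported function from monomials to coefficients; the product of
  polynomials is the convolution product of \<^theory>\<open>HOL-Library.Poly_Mapping\<close>. The product
  of two monomials is the sum of their exponent vectors.
\<close>

type_synonym 'v monom = "'v \<Rightarrow>\<^sub>0 nat"
type_synonym ('v, 'k) mpoly = "'v monom \<Rightarrow>\<^sub>0 'k"

definition mdegree :: "'v monom \<Rightarrow> nat" where
  "mdegree t = (\<Sum>v\<in>Poly_Mapping.keys t. Poly_Mapping.lookup t v)"

text \<open>The degree is an integer so that for \<open>i < 0\<close> only the zero polynomial qualifies.\<close>

definition homogeneous :: "int \<Rightarrow> ('v, 'k::zero) mpoly \<Rightarrow> bool" where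
  "homogeneous i p \<longleftrightarrow> (\<forall>t\<in>Poly_Mapping.keys p. int (mdegree t) = i)"

definition poly_eval ::
  "('k::zero \<Rightarrow> 'a::comm_ring_1) \<Rightarrow> ('v \<Rightarrow> 'a) \<Rightarrow> ('v, 'k) mpoly \<Rightarrow> 'a" where
  "poly_eval \<iota> a p =
    (\<Sum>t\<in>Poly_Mapping.keys p. \<iota> (Poly_Mapping.lookup p t) *
       (\<Prod>v\<in>Poly_Mapping.keys t. a v ^ Poly_Mapping.lookup t v))"

abbreviation ideal_gen :: "'r::comm_ring_1 set \<Rightarrow> 'r set" where
  "ideal_gen B \<equiv> module.span (*) B"

definition monomial_order :: "('v monom \<Rightarrow> 'v monom \<Rightarrow> bool) \<Rightarrow> bool" where
  "monomial_order lt \<longleftrightarrow>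
    irreflp lt \<and> transp lt \<and> totalp lt \<and>
    (\<forall>t. t \<noteq> 0 \<longrightarrow> lt 0 t) \<and>
    (\<forall>s t u. lt s t \<longrightarrow> lt (s + u) (t + u))"

definition leading_monomial ::
  "('v monom \<Rightarrow> 'v monom \<Rightarrow> bool) \<Rightarrow> ('v, 'k::zero) mpoly \<Rightarrow> 'v monom" where
  "leading_monomial lt p =
    (THE t. t \<in> Poly_Mapping.keys p \<and> (\<forall>s\<in>Poly_Mapping.keys p. s \<noteq> t \<longrightarrow> lt s t))"

definition initial_ideal ::
  "('v monom \<Rightarrow> 'v monom \<Rightarrow> bool) \<Rightarrow> ('v, 'k::comm_ring_1) mpoly set \<Rightarrow> ('v, 'k) mpoly set" where
  "initial_ideal lt J =
    ideal_gen {Poly_Mapping.single (leading_monomial lt p) 1 | p. p \<in> J \<and> p \<noteq> 0}"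

text \<open>The monomials of \<open>I\<close> that are minimal with respect to divisibility.\<close>

definition minimal_monomial_generators :: "('v, 'k::comm_ring_1) mpoly set \<Rightarrow> 'v monom set" where
  "minimal_monomial_generators I =
    {t. Poly_Mapping.single t 1 \<in> I \<and>
        (\<forall>s u. t = s + u \<longrightarrow> Poly_Mapping.single s 1 \<in> I \<longrightarrow> u = 0)}"

text \<open>
  In \<open>T = K[x, y]\<close> the variable \<open>x\<^sub>i\<close> is \<open>Inl i\<close> and \<open>y\<^sub>j\<close> is \<open>Inr j\<close>. A monomial of \<open>T\<close>
  is uniquely a product \<open>u w\<close> with \<open>u\<close> its \<open>x\<close>-part and \<open>w\<close> its \<open>y\<close>-part.
\<close>

definition x_part :: "('x + 'y) monom \<Rightarrow> 'x monom" where
  "x_part t = Poly_Mapping.map_key Inl t"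

definition y_part :: "('x + 'y) monom \<Rightarrow> 'y monom" where
  "y_part t = Poly_Mapping.map_key Inr t"

definition product_order ::
  "('y monom \<Rightarrow> 'y monom \<Rightarrow> bool) \<Rightarrow> ('x monom \<Rightarrow> 'x monom \<Rightarrow> bool) \<Rightarrow>
   ('x + 'y) monom \<Rightarrow> ('x + 'y) monom \<Rightarrow> bool" where
  "product_order lt_y lt_x s t \<longleftrightarrow>
    lt_y (y_part s) (y_part t) \<or> y_part s = y_part t \<and> lt_x (x_part s) (x_part t)"

definition x_condition ::
  "(('x + 'y) monom \<Rightarrow> ('x + 'y) monom \<Rightarrow> bool) \<Rightarrow> ('x + 'y, 'k::comm_ring_1) mpoly set \<Rightarrow> bool" where
  "x_condition lt J \<longleftrightarrow>
    (\<forall>t \<in> minimal_monomial_generators (initial_ideal lt J). mdegree (x_part t) \<le> 1)"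

section \<open>Linear quotients\<close>

text \<open>
  \<open>M\<close> is a submodule of the \<open>S\<close>-module with scalar multiplication \<open>scale\<close>. The zero colon
  ideal is covered by \<open>L = {}\<close>; indices start at \<open>0\<close>.
\<close>

definition has_linear_quotients ::
  "(('x, 'k::comm_ring_1) mpoly \<Rightarrow> 'm::ab_group_add \<Rightarrow> 'm) \<Rightarrow> 'm set \<Rightarrow> bool" where
  "has_linear_quotients scale M \<longleftrightarrow>
    (\<exists>gs. module.span scale (set gs) = M \<and>
      (\<forall>j<length gs.
        let I = {h. scale h (gs ! j) \<in> module.span scale (set (take j gs))}
        in I = UNIV \<or> (\<exists>L. (\<forall>l\<in>L. homogeneous 1 l) \<and> I = ideal_gen L)))"

section \<open>Bigraded algebras\<close>

definition graded_sum :: "('i \<Rightarrow> 'a::comm_monoid_add set) \<Rightarrow> 'a set" where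
  "graded_sum B =
    {\<Sum>i\<in>Poly_Mapping.keys c. Poly_Mapping.lookup c i | c. \<forall>i. Poly_Mapping.lookup c i \<in> B i}"

definition is_subring :: "'a::comm_ring_1 set \<Rightarrow> bool" where
  "is_subring R \<longleftrightarrow> 1 \<in> R \<and> (\<forall>a\<in>R. \<forall>b\<in>R. a - b \<in> R \<and> a * b \<in> R)"

text \<open>
  The algebra is the whole type \<open>'a\<close>, with structure map \<open>\<iota> : K \<rightarrow> A\<close>; it is injective since
  \<open>K\<close> is a field and \<open>1 \<noteq> 0\<close> in \<open>'a\<close>.
\<close>

locale bigraded_algebra =
  fixes \<iota> :: "'k::field \<Rightarrow> 'a::comm_ring_1"
    and A :: "int \<times> int \<Rightarrow> 'a set"
  assumes iota_one: "\<iota> 1 = 1"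
    and iota_add: "\<iota> (r + s) = \<iota> r + \<iota> s"
    and iota_mult: "\<iota> (r * s) = \<iota> r * \<iota> s"
    and component_subspace: "module.subspace (\<lambda>c a. \<iota> c * a) (A d)"
    and direct_sum: "\<exists>!c. (\<forall>d. Poly_Mapping.lookup c d \<in> A d) \<and>
          a = (\<Sum>d\<in>Poly_Mapping.keys c. Poly_Mapping.lookup c d)"
    and component_mult: "a \<in> A d \<Longrightarrow> b \<in> A e \<Longrightarrow> a * b \<in> A (d + e)"
    and component_zero: "A (0, 0) = range \<iota>"
begin

text \<open>\<open>A\<^sub>j = \<Oplus>\<^sub>i A\<^sub>(\<^sub>i\<^sub>,\<^sub>j\<^sub>)\<close>\<close>

definition part :: "int \<Rightarrow> 'a set" where
  "part j = graded_sum (\<lambda>i. A (i, j))"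

end

definition S_scale ::
  "('k::field \<Rightarrow> 'a::comm_ring_1) \<Rightarrow> ('x \<Rightarrow> 'a) \<Rightarrow> ('x, 'k) mpoly \<Rightarrow> 'a \<Rightarrow> 'a" where
  "S_scale \<iota> x h a = poly_eval \<iota> x h * a"

text \<open>
  Here \<open>n\<close> is the cardinality of \<open>'x\<close>. The first two assumptions say that evaluation at the
  \<open>x\<^sub>i\<close> is an isomorphism of graded rings from \<open>S\<close> onto \<open>A\<^sub>0\<close>; \<open>S\<close> acts on \<open>A\<close> through it.
  The last one says \<open>A = S[A\<^sub>1]\<close>; as \<open>A\<close> is bigraded, this amounts to \<open>A\<^sub>j = A\<^sub>1\<^sup>j\<close> for
  \<open>j \<ge> 1\<close> together with \<open>A\<^sub>j = 0\<close> for \<open>j < 0\<close>.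
\<close>

locale standard_bigraded_algebra = bigraded_algebra \<iota> A
  for \<iota> :: "'k::field \<Rightarrow> 'a::comm_ring_1" and A :: "int \<times> int \<Rightarrow> 'a set" +
  fixes x :: "'x::finite \<Rightarrow> 'a"
  assumes part_zero_iso: "bij_betw (poly_eval \<iota> x) UNIV (part 0)"
    and part_zero_grading: "poly_eval \<iota> x ` {p. homogeneous i p} = A (i, 0)"
    and part_one_fg: "\<exists>F. finite F \<and> module.span (S_scale \<iota> x) F = part 1"
    and part_one_nonneg: "i < 0 \<Longrightarrow> A (i, 1) = {0}"
    and generated: "is_subring hull (part 0 \<union> part 1) = UNIV"

locale presented_bigraded_algebra = standard_bigraded_algebra \<iota> A x
  for \<iota> :: "'k::field \<Rightarrow> 'a::comm_ring_1" and A :: "int \<times> int \<Rightarrow> 'a set"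
    and x :: "'x::finite \<Rightarrow> 'a" +
  fixes f :: "'y::finite \<Rightarrow> 'a" and \<delta> :: "'y \<Rightarrow> int"
  assumes f_homogeneous: "f j \<in> A (\<delta> j, 1)"
    and f_generates: "module.span (S_scale \<iota> x) (range f) = part 1"

definition presentation ::
  "('k::field \<Rightarrow> 'a::comm_ring_1) \<Rightarrow> ('x \<Rightarrow> 'a) \<Rightarrow> ('y \<Rightarrow> 'a) \<Rightarrow> ('x + 'y, 'k) mpoly \<Rightarrow> 'a" where
  "presentation \<iota> x f = poly_eval \<iota> (case_sum x f)"

definition presentation_ideal ::
  "('k::field \<Rightarrow> 'a::comm_ring_1) \<Rightarrow> ('x \<Rightarrow> 'a) \<Rightarrow> ('y \<Rightarrow> 'a) \<Rightarrow> ('x + 'y, 'k) mpoly set" where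
  "presentation_ideal \<iota> x f = {p. presentation \<iota> x f p = 0}"

end

theory Submission
  imports Defs "HOL-Library.FuncSet"
begin

text \<open>
  Let \<open>w\<^sub>1, \<dots>, w\<^sub>r\<close> be the monomials of degree \<open>k\<close> in the \<open>y\<^sub>j\<close>, listed increasingly for the order on
  \<open>K[y]\<close>, and let \<open>g\<^sub>j = \<phi>(w\<^sub>j)\<close>. These elements generate \<open>A\<^sub>k\<close> over \<open>S\<close> (\<open>part_eq_span\<close>), and they give
  linear quotients.

  A polynomial \<open>h\<close> lies in the colon ideal \<open>I = (g\<^sub>1, \<dots>, g\<^sub>j\<^sub>-\<^sub>1) : g\<^sub>j\<close> iff \<open>h\<close> is the coefficient of \<open>w\<^sub>j\<close> in
  some \<open>p = h w\<^sub>j + \<Sum>\<^sub>i\<^sub><\<^sub>j h\<^sub>i w\<^sub>i\<close> in \<open>J\<close> (\<open>colon_iff\<close>). The product order compares \<open>y\<close>-parts first, so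
  the leading monomial of such a \<open>p\<close> is \<open>u w\<^sub>j\<close>, where \<open>u\<close> is the leading monomial of \<open>h\<close>. By the
  \<open>x\<close>-condition \<open>u w\<^sub>j\<close> is a multiple of a monomial \<open>v w\<close> of the initial ideal with \<open>v\<close> of degree at
  most one; then \<open>v\<close> divides \<open>u\<close>, and \<open>v w\<^sub>j\<close> is in the initial ideal as well. Since \<open>J\<close> is bigraded,
  \<open>v w\<^sub>j\<close> is the leading monomial of a bihomogeneous element of \<open>J\<close>. Its monomials all have
  \<open>y\<close>-degree \<open>k\<close> and \<open>y\<close>-part at most \<open>w\<^sub>j\<close>, so its coefficient at \<open>w\<^sub>j\<close> is again an element of \<open>I\<close>;
  it is homogeneous of degree at most one, and its leading monomial \<open>v\<close> divides that of \<open>h\<close>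
  (\<open>colon_divisor\<close>).

  If a constant arises in this way, then \<open>I = S\<close>. Otherwise each nonzero element of \<open>I\<close> can be
  reduced by linear forms of \<open>I\<close>, and the division algorithm shows that these linear forms
  generate \<open>I\<close> (\<open>ideal_UNIV_or_linear\<close>).
\<close>

section \<open>Monomials\<close>

lemma mdegree_sum_UNIV: "mdegree (t :: 'v::finite monom) = (\<Sum>v\<in>UNIV. Poly_Mapping.lookup t v)"
  unfolding mdegree_def by (rule sum.mono_neutral_left) (auto simp: in_keys_iff)

lemma mdegree_add: "mdegree (s + t :: 'v::finite monom) = mdegree s + mdegree t"
  by (simp add: mdegree_sum_UNIV lookup_add sum.distrib)

lemma mdegree_eq_0_iff: "mdegree (t :: 'v::finite monom) = 0 \<longleftrightarrow> t = 0"
  by (simp add: mdegree_sum_UNIV poly_mapping_eq_iff fun_eq_iff)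

lemma finite_mdegree_le: "finite {t :: 'v::finite monom. mdegree t \<le> D}"
proof -
  have le: "Poly_Mapping.lookup t v \<le> D" if "mdegree t \<le> D" for t :: "'v monom" and v
    using that member_le_sum[of v UNIV "Poly_Mapping.lookup t"] by (simp add: mdegree_sum_UNIV)
  have "Poly_Mapping.lookup ` {t :: 'v monom. mdegree t \<le> D} \<subseteq> UNIV \<rightarrow>\<^sub>E {..D}"
    using le by auto
  moreover have "finite ((UNIV :: 'v set) \<rightarrow>\<^sub>E {..D})"
    by (rule finite_PiE) simp_all
  ultimately have "finite (Poly_Mapping.lookup ` {t :: 'v monom. mdegree t \<le> D})"
    by (rule finite_subset)
  moreover have "inj_on Poly_Mapping.lookup {t :: 'v monom. mdegree t \<le> D}"
    by (rule inj_onI) (simp only: poly_mapping_eq_iff)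
  ultimately show ?thesis
    by (rule finite_imageD)
qed

text \<open>The inverse of splitting a monomial into its \<open>x\<close>-part and its \<open>y\<close>-part.\<close>

definition join_monom :: "'x::finite monom \<Rightarrow> 'y::finite monom \<Rightarrow> ('x + 'y) monom" where
  "join_monom u w = Abs_poly_mapping (case_sum (Poly_Mapping.lookup u) (Poly_Mapping.lookup w))"

lemma lookup_join_monom:
  "Poly_Mapping.lookup (join_monom u w) = case_sum (Poly_Mapping.lookup u) (Poly_Mapping.lookup w)"
  unfolding join_monom_def by (rule lookup_Abs_poly_mapping) simp

lemma lookup_x_part: "Poly_Mapping.lookup (x_part t) i = Poly_Mapping.lookup t (Inl i)"
  by (simp add: x_part_def map_key.rep_eq)

lemma lookup_y_part: "Poly_Mapping.lookup (y_part t) j = Poly_Mapping.lookup t (Inr j)"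
  by (simp add: y_part_def map_key.rep_eq)

lemma x_part_add: "x_part (s + t) = x_part s + x_part t"
  by (simp add: x_part_def map_key_plus)

lemma y_part_add: "y_part (s + t) = y_part s + y_part t"
  by (simp add: y_part_def map_key_plus)

lemma x_part_join [simp]: "x_part (join_monom u w) = u"
  by (rule poly_mapping_eqI) (simp add: lookup_x_part lookup_join_monom)

lemma y_part_join [simp]: "y_part (join_monom u w) = w"
  by (rule poly_mapping_eqI) (simp add: lookup_y_part lookup_join_monom)

lemma join_monom_parts [simp]: "join_monom (x_part t) (y_part t) = t"
proof (rule poly_mapping_eqI)
  fix v :: "'a + 'b"
  show "Poly_Mapping.lookup (join_monom (x_part t) (y_part t)) v = Poly_Mapping.lookup t v"
    by (cases v) (auto simp: lookup_join_monom lookup_x_part lookup_y_part)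
qed

lemma monom_eqI: "x_part s = x_part t \<Longrightarrow> y_part s = y_part t \<Longrightarrow> s = (t :: ('x::finite + 'y::finite) monom)"
  by (metis join_monom_parts)

section \<open>Leading monomials and initial ideals\<close>

lemma monomial_order_irrefl: "monomial_order lt \<Longrightarrow> \<not> lt t t"
  by (auto simp: monomial_order_def dest: irreflpD)

lemma monomial_order_trans: "monomial_order lt \<Longrightarrow> lt s t \<Longrightarrow> lt t u \<Longrightarrow> lt s u"
  by (auto simp: monomial_order_def dest: transpD)

lemma monomial_order_total: "monomial_order lt \<Longrightarrow> s \<noteq> t \<Longrightarrow> lt s t \<or> lt t s"
  by (auto simp: monomial_order_def dest: totalpD)

lemma monomial_order_add: "monomial_order lt \<Longrightarrow> lt s t \<Longrightarrow> lt (u + s) (u + t)"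
  by (auto simp: monomial_order_def add.commute)

lemma monomial_order_product_order:
  fixes lt_y :: "'y::finite monom \<Rightarrow> 'y monom \<Rightarrow> bool" and lt_x :: "'x::finite monom \<Rightarrow> 'x monom \<Rightarrow> bool"
  assumes y: "monomial_order lt_y" and x: "monomial_order lt_x"
  shows "monomial_order (product_order lt_y lt_x)"
  unfolding monomial_order_def
proof (intro conjI allI impI)
  show "irreflp (product_order lt_y lt_x)"
    using monomial_order_irrefl[OF x] monomial_order_irrefl[OF y]
    by (auto intro!: irreflpI simp: product_order_def)
  show "transp (product_order lt_y lt_x)"
    using monomial_order_trans[OF x] monomial_order_trans[OF y]
    unfolding product_order_def by (intro transpI) (elim disjE conjE, auto)
  show "totalp (product_order lt_y lt_x)"
    using monomial_order_total[OF x] monomial_order_total[OF y]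
    unfolding product_order_def by (intro totalpI) (use monom_eqI in blast)
next
  fix t :: "('x + 'y) monom" assume "t \<noteq> 0"
  moreover have "x_part (0 :: ('x + 'y) monom) = 0" "y_part (0 :: ('x + 'y) monom) = 0"
    by (simp_all add: x_part_def y_part_def)
  ultimately show "product_order lt_y lt_x 0 t"
    using x y monom_eqI[of t 0] unfolding product_order_def monomial_order_def by (metis (no_types))
next
  fix s t u :: "('x + 'y) monom" assume "product_order lt_y lt_x s t"
  then show "product_order lt_y lt_x (s + u) (t + u)"
    using x y unfolding product_order_def monomial_order_def by (auto simp: x_part_add y_part_add)
qed

lemma monomial_order_ex_max:
  assumes lt: "monomial_order lt" and "finite W" "W \<noteq> {}"
  shows "\<exists>t\<in>W. \<forall>s\<in>W. s \<noteq> t \<longrightarrow> lt s t"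
  using assms(2,3)
proof (induction W rule: finite_ne_induct)
  case (insert w W)
  then obtain t where t: "t \<in> W" "\<forall>s\<in>W. s \<noteq> t \<longrightarrow> lt s t" by blast
  show ?case
  proof (cases "lt w t")
    case False
    have "w \<noteq> t" using insert.hyps t by auto
    then have "lt t w" using monomial_order_total[OF lt, of w t] False by simp
    then have "lt s w" if "s \<in> W" for s
      using t that monomial_order_trans[OF lt, of s t w] by (cases "s = t") auto
    then show ?thesis by auto
  next
    case True
    then show ?thesis using t by auto
  qed
qed simp

lemma monomial_order_sorted_list:
  assumes lt: "monomial_order lt" and "finite W"
  shows "\<exists>ws. set ws = W \<and> sorted_wrt lt ws"
  using \<open>finite W\<close>
proof (induction W rule: finite_remove_induct)
  case (remove W)
  obtain t where t: "t \<in> W" "\<forall>s\<in>W. s \<noteq> t \<longrightarrow> lt s t"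
    using monomial_order_ex_max[OF lt remove.hyps(1,2)] by blast
  obtain ws where "set ws = W - {t}" "sorted_wrt lt ws"
    using remove.IH[OF t(1)] by blast
  then have "set (ws @ [t]) = W" "sorted_wrt lt (ws @ [t])"
    using t by (auto simp: sorted_wrt_append)
  then show ?case by blast
qed simp

lemma leading_monomial_eqI:
  assumes "monomial_order lt" "t \<in> Poly_Mapping.keys p"
    and "\<And>s. s \<in> Poly_Mapping.keys p \<Longrightarrow> s \<noteq> t \<Longrightarrow> lt s t"
  shows "leading_monomial lt p = t"
  unfolding leading_monomial_def
proof (rule the_equality)
  fix s assume s: "s \<in> Poly_Mapping.keys p \<and> (\<forall>r\<in>Poly_Mapping.keys p. r \<noteq> s \<longrightarrow> lt r s)"
  show "s = t"
  proof (rule ccontr)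
    assume "s \<noteq> t"
    then have "lt s t" "lt t s" using assms s by auto
    then have "lt t t" by (rule monomial_order_trans[OF assms(1), rotated])
    then show False using monomial_order_irrefl[OF assms(1)] by simp
  qed
qed (use assms in auto)

text \<open>The leading monomial is a definite description; it denotes because a finite nonempty set has a
  greatest element for a strict total order.\<close>

lemma
  assumes lt: "monomial_order lt" and "p \<noteq> 0"
  shows leading_monomial_in_keys: "leading_monomial lt p \<in> Poly_Mapping.keys p"
    and leading_monomial_greatest:
      "\<And>s. s \<in> Poly_Mapping.keys p \<Longrightarrow> s \<noteq> leading_monomial lt p \<Longrightarrow> lt s (leading_monomial lt p)"
proof -
  obtain t where t: "t \<in> Poly_Mapping.keys p" "\<forall>s\<in>Poly_Mapping.keys p. s \<noteq> t \<longrightarrow> lt s t"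
    using monomial_order_ex_max[OF lt, of "Poly_Mapping.keys p"] \<open>p \<noteq> 0\<close> by auto
  then have "leading_monomial lt p = t"
    by (intro leading_monomial_eqI[OF lt]) auto
  then show "leading_monomial lt p \<in> Poly_Mapping.keys p"
    "\<And>s. s \<in> Poly_Mapping.keys p \<Longrightarrow> s \<noteq> leading_monomial lt p \<Longrightarrow> lt s (leading_monomial lt p)"
    using t by auto
qed

lemma lookup_single_mult:
  "Poly_Mapping.lookup (Poly_Mapping.single u c * p) (u + t) = c * Poly_Mapping.lookup p t"
  for u t :: "'m::cancel_comm_monoid_add" and c :: "'k::semiring_0"
  by (simp add: lookup_mult lookup_single when_mult)

lemma keys_single_mult:
  "Poly_Mapping.keys (Poly_Mapping.single u c * p) \<subseteq> (+) u ` Poly_Mapping.keys p"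
  using keys_mult[of "Poly_Mapping.single u c" p] by (auto split: if_splits)

text \<open>Over a field the product of nonzero coefficients is nonzero, so multiplying by a term shifts
  the leading monomial.\<close>

lemma leading_monomial_single_mult:
  fixes p :: "('v, 'k::field) mpoly"
  assumes lt: "monomial_order lt" and p: "p \<noteq> 0" and c: "c \<noteq> 0"
  shows "Poly_Mapping.single u c * p \<noteq> 0"
    and "leading_monomial lt (Poly_Mapping.single u c * p) = u + leading_monomial lt p"
proof -
  let ?q = "Poly_Mapping.single u c * p"
  have in_keys: "u + leading_monomial lt p \<in> Poly_Mapping.keys ?q"
    using leading_monomial_in_keys[OF lt p] c by (simp add: in_keys_iff lookup_single_mult)
  then show "?q \<noteq> 0" by auto
  show "leading_monomial lt ?q = u + leading_monomial lt p"
  proof (rule leading_monomial_eqI[OF lt in_keys])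
    fix s assume "s \<in> Poly_Mapping.keys ?q" "s \<noteq> u + leading_monomial lt p"
    then obtain t where "s = u + t" "t \<in> Poly_Mapping.keys p" "t \<noteq> leading_monomial lt p"
      using keys_single_mult[of u c p] by blast
    then show "lt s (u + leading_monomial lt p)"
      using leading_monomial_greatest[OF lt p] monomial_order_add[OF lt] by simp
  qed
qed

interpretation ring_module: module "(*) :: 'r::comm_ring_1 \<Rightarrow> 'r \<Rightarrow> 'r"
  by unfold_locales (auto simp: algebra_simps)

text \<open>Polynomials all of whose monomials are multiples of leading monomials of \<open>J\<close> form an ideal that
  contains the generators of the initial ideal. Hence a monomial of the initial ideal is a multiple
  \<open>u m\<close> of a leading monomial \<open>m\<close> of some \<open>p \<in> J\<close>, and \<open>u m\<close> is the leading monomial of \<open>u p \<in> J\<close>.\<close>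

lemma monomial_in_initial_ideal_iff:
  fixes J :: "('v::finite, 'k::field) mpoly set"
  assumes lt: "monomial_order lt" and J: "module.subspace (*) J"
  shows "Poly_Mapping.single t 1 \<in> initial_ideal lt J \<longleftrightarrow> (\<exists>p\<in>J. p \<noteq> 0 \<and> leading_monomial lt p = t)"
proof
  let ?D = "{q :: ('v, 'k) mpoly. \<forall>t\<in>Poly_Mapping.keys q. \<exists>p\<in>J. \<exists>u. p \<noteq> 0 \<and> t = u + leading_monomial lt p}"
  have "ring_module.subspace ?D"
  proof (rule ring_module.subspaceI)
    show "p + q \<in> ?D" if "p \<in> ?D" "q \<in> ?D" for p q
      using that Poly_Mapping.keys_add[of p q] by blast
    show "r * q \<in> ?D" if q: "q \<in> ?D" for r q
    proof clarify
      fix t assume "t \<in> Poly_Mapping.keys (r * q)"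
      then obtain a b where "t = a + b" "b \<in> Poly_Mapping.keys q"
        using keys_mult[of r q] by blast
      moreover obtain p u where "p \<in> J" "p \<noteq> 0" "b = u + leading_monomial lt p"
        using q \<open>b \<in> Poly_Mapping.keys q\<close> by blast
      ultimately have "p \<in> J" "p \<noteq> 0" "t = (a + u) + leading_monomial lt p"
        by (simp_all add: add.assoc)
      then show "\<exists>p\<in>J. \<exists>u. p \<noteq> 0 \<and> t = u + leading_monomial lt p" by blast
    qed
  qed simp
  then have "initial_ideal lt J \<subseteq> ?D"
    unfolding initial_ideal_def
  proof (rule ring_module.span_minimal[rotated], safe)
    fix p s
    assume "p \<in> J" "p \<noteq> 0" "s \<in> Poly_Mapping.keys (Poly_Mapping.single (leading_monomial lt p) (1 :: 'k))"
    moreover from this have "s = 0 + leading_monomial lt p" by simp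
    ultimately show "\<exists>p\<in>J. \<exists>u. p \<noteq> 0 \<and> s = u + leading_monomial lt p" by blast
  qed
  moreover assume "Poly_Mapping.single t 1 \<in> initial_ideal lt J"
  moreover have "t \<in> Poly_Mapping.keys (Poly_Mapping.single t (1 :: 'k))" by simp
  ultimately obtain p u where p: "p \<in> J" "p \<noteq> 0" "t = u + leading_monomial lt p" by blast
  let ?q = "Poly_Mapping.single u 1 * p"
  have "?q \<in> J" "?q \<noteq> 0" "leading_monomial lt ?q = t"
    using leading_monomial_single_mult[OF lt, of p 1 u] ring_module.subspace_scale[OF J] p by simp_all
  then show "\<exists>p\<in>J. p \<noteq> 0 \<and> leading_monomial lt p = t" by blast
next
  assume "\<exists>p\<in>J. p \<noteq> 0 \<and> leading_monomial lt p = t"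
  then show "Poly_Mapping.single t 1 \<in> initial_ideal lt J"
    unfolding initial_ideal_def by (intro ring_module.span_base) auto
qed

lemma ex_minimal_monomial_generator:
  fixes t :: "'v::finite monom"
  assumes "Poly_Mapping.single t 1 \<in> I"
  shows "\<exists>s u. t = s + u \<and> s \<in> minimal_monomial_generators I"
  using assms
proof (induction "mdegree t" arbitrary: t rule: less_induct)
  case less
  show ?case
  proof (cases "t \<in> minimal_monomial_generators I")
    case True
    then have "t = t + 0 \<and> t \<in> minimal_monomial_generators I" by simp
    then show ?thesis by blast
  next
    case False
    then obtain s u where su: "t = s + u" "Poly_Mapping.single s 1 \<in> I" "u \<noteq> 0"
      using less.prems unfolding minimal_monomial_generators_def by blast
    then have "mdegree s < mdegree t"
      using mdegree_eq_0_iff[of u] by (simp add: mdegree_add)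
    then obtain s' u' where "s = s' + u'" "s' \<in> minimal_monomial_generators I"
      using less.hyps[of s] su by blast
    then have "t = s' + (u' + u) \<and> s' \<in> minimal_monomial_generators I"
      using su by (simp add: add.assoc)
    then show ?thesis by blast
  qed
qed

section \<open>Evaluation of polynomials\<close>

definition monom_eval :: "('v \<Rightarrow> 'a::comm_ring_1) \<Rightarrow> 'v monom \<Rightarrow> 'a" where
  "monom_eval a t = (\<Prod>v\<in>Poly_Mapping.keys t. a v ^ Poly_Mapping.lookup t v)"

lemma monom_eval_UNIV:
  "monom_eval a (t :: 'v::finite monom) = (\<Prod>v\<in>UNIV. a v ^ Poly_Mapping.lookup t v)"
  unfolding monom_eval_def by (rule prod.mono_neutral_left) (auto simp: in_keys_iff)

lemma monom_eval_add: "monom_eval a (s + t :: 'v::finite monom) = monom_eval a s * monom_eval a t"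
  by (simp add: monom_eval_UNIV lookup_add power_add prod.distrib)

lemma monom_eval_case_sum:
  "monom_eval (case_sum a b) t = monom_eval a (x_part t) * monom_eval b (y_part t)"
  for t :: "('x::finite + 'y::finite) monom"
  by (simp add: monom_eval_UNIV lookup_x_part lookup_y_part UNIV_Plus_UNIV[symmetric] prod.Plus
      del: UNIV_Plus_UNIV)

lemma poly_mapping_sum_single:
  "(\<Sum>t\<in>Poly_Mapping.keys p. Poly_Mapping.single t (Poly_Mapping.lookup p t)) = p"
  by (rule poly_mapping_eqI) (auto simp: lookup_sum lookup_single when_def in_keys_iff)

context bigraded_algebra
begin

lemma iota_zero: "\<iota> 0 = 0"
  using iota_add[of 0 0] by simp

text \<open>Two polynomials can be evaluated over a common set of monomials, which makes additivity a
  termwise statement.\<close>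

lemma poly_eval_superset:
  assumes "finite T" "Poly_Mapping.keys p \<subseteq> T"
  shows "poly_eval \<iota> a p = (\<Sum>t\<in>T. \<iota> (Poly_Mapping.lookup p t) * monom_eval a t)"
  unfolding poly_eval_def monom_eval_def
  by (rule sum.mono_neutral_left) (use assms in \<open>auto simp: in_keys_iff iota_zero\<close>)

lemma poly_eval_zero: "poly_eval \<iota> a 0 = 0"
  by (simp add: poly_eval_def)

lemma poly_eval_add: "poly_eval \<iota> a (p + q) = poly_eval \<iota> a p + poly_eval \<iota> a q"
proof -
  let ?T = "Poly_Mapping.keys p \<union> Poly_Mapping.keys q"
  have "Poly_Mapping.keys (p + q) \<subseteq> ?T" by (rule Poly_Mapping.keys_add)
  then show ?thesis
    by (simp add: poly_eval_superset[of ?T] lookup_add iota_add distrib_right sum.distrib)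
qed

lemma poly_eval_diff: "poly_eval \<iota> a (p - q) = poly_eval \<iota> a p - poly_eval \<iota> a q"
  using poly_eval_add[of a "p - q" q] by simp

lemma poly_eval_sum: "poly_eval \<iota> a (\<Sum>i\<in>I. p i) = (\<Sum>i\<in>I. poly_eval \<iota> a (p i))"
  by (induction I rule: infinite_finite_induct) (simp_all add: poly_eval_zero poly_eval_add)

lemma poly_eval_single: "poly_eval \<iota> a (Poly_Mapping.single t c) = \<iota> c * monom_eval a t"
  by (simp add: poly_eval_superset[of "{t}"])

lemma poly_eval_mult:
  fixes p q :: "('v::finite, 'k) mpoly"
  shows "poly_eval \<iota> a (p * q) = poly_eval \<iota> a p * poly_eval \<iota> a q"
proof -
  define m where "m r t = Poly_Mapping.single t (Poly_Mapping.lookup r t)" for r :: "('v, 'k) mpoly" and t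
  have m_sum: "(\<Sum>t\<in>Poly_Mapping.keys r. m r t) = r" for r
    unfolding m_def by (rule poly_mapping_sum_single)
  have m_mult: "poly_eval \<iota> a (m p s * m q t) = poly_eval \<iota> a (m p s) * poly_eval \<iota> a (m q t)" for s t
    unfolding m_def mult_single poly_eval_single iota_mult monom_eval_add by (simp only: mult_ac)
  have "poly_eval \<iota> a (p * q) =
      poly_eval \<iota> a ((\<Sum>s\<in>Poly_Mapping.keys p. m p s) * (\<Sum>t\<in>Poly_Mapping.keys q. m q t))"
    by (simp only: m_sum)
  also have "\<dots> = poly_eval \<iota> a (\<Sum>s\<in>Poly_Mapping.keys p. m p s) *
      poly_eval \<iota> a (\<Sum>t\<in>Poly_Mapping.keys q. m q t)"
    by (simp only: sum_product poly_eval_sum m_mult)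
  finally show ?thesis by (simp only: m_sum)
qed

lemma poly_eval_one: "poly_eval \<iota> a 1 = 1"
  using poly_eval_single[of a 0 1] by (simp add: monom_eval_def iota_one)

lemma module_S_scale: "module (S_scale \<iota> (x :: 'x::finite \<Rightarrow> 'a))"
  by (rule module.intro)
    (simp_all only: S_scale_def poly_eval_add poly_eval_mult poly_eval_one distrib_left distrib_right
      mult.assoc mult_1)

end

section \<open>Polynomials in the y-variables over S\<close>

text \<open>Viewing \<open>T\<close> as \<open>S[y]\<close>, the first function forms the product \<open>h w\<close> of \<open>h \<in> S\<close> with a monomial \<open>w\<close>
  in the \<open>y\<^sub>j\<close>, and the second one reads off the coefficient in \<open>S\<close> of such a monomial.\<close>

definition y_monomial_term :: "('x::finite, 'k::comm_ring_1) mpoly \<Rightarrow> 'y::finite monom \<Rightarrow> ('x + 'y, 'k) mpoly" where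
  "y_monomial_term h w =
    (\<Sum>u\<in>Poly_Mapping.keys h. Poly_Mapping.single (join_monom u w) (Poly_Mapping.lookup h u))"

definition y_coeff :: "('x::finite + 'y::finite, 'k::zero) mpoly \<Rightarrow> 'y monom \<Rightarrow> ('x, 'k) mpoly" where
  "y_coeff p w = Poly_Mapping.map_key (\<lambda>u. join_monom u w) p"

lemma lookup_y_monomial_term:
  "Poly_Mapping.lookup (y_monomial_term h w) t =
    (if y_part t = w then Poly_Mapping.lookup h (x_part t) else 0)"
proof -
  have eq_iff: "join_monom u w = t \<longleftrightarrow> u = x_part t \<and> y_part t = w" for u
    by auto
  have "Poly_Mapping.lookup (y_monomial_term h w) t =
      (\<Sum>u\<in>Poly_Mapping.keys h. if u = x_part t \<and> y_part t = w then Poly_Mapping.lookup h u else 0)"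
    by (simp only: y_monomial_term_def lookup_sum lookup_single when_def eq_iff)
  also have "\<dots> = (if y_part t = w then Poly_Mapping.lookup h (x_part t) else 0)"
    by (cases "y_part t = w") (simp_all add: in_keys_iff)
  finally show ?thesis .
qed

lemma lookup_y_coeff:
  fixes p :: "('x::finite + 'y::finite, 'k::zero) mpoly"
  shows "Poly_Mapping.lookup (y_coeff p w) u = Poly_Mapping.lookup p (join_monom u w)"
proof -
  have "inj (\<lambda>u :: 'x monom. join_monom u w)"
    by (rule injI) (metis x_part_join)
  then show ?thesis unfolding y_coeff_def by (simp add: map_key.rep_eq)
qed

lemma y_expansion: "(\<Sum>w\<in>y_part ` Poly_Mapping.keys p. y_monomial_term (y_coeff p w) w) = p"
proof (rule poly_mapping_eqI)
  fix t
  have "Poly_Mapping.lookup (\<Sum>w\<in>y_part ` Poly_Mapping.keys p. y_monomial_term (y_coeff p w) w) t =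
      (\<Sum>w\<in>y_part ` Poly_Mapping.keys p.
        if y_part t = w then Poly_Mapping.lookup p (join_monom (x_part t) w) else 0)"
    by (simp only: lookup_sum lookup_y_monomial_term lookup_y_coeff)
  also have "\<dots> = (if y_part t \<in> y_part ` Poly_Mapping.keys p then Poly_Mapping.lookup p t else 0)"
    by simp
  also have "\<dots> = Poly_Mapping.lookup p t"
    by (auto simp: in_keys_iff)
  finally show "Poly_Mapping.lookup
      (\<Sum>w\<in>y_part ` Poly_Mapping.keys p. y_monomial_term (y_coeff p w) w) t = Poly_Mapping.lookup p t" .
qed

context bigraded_algebra
begin

lemma presentation_y_monomial_term:
  "presentation \<iota> x f (y_monomial_term h w) = S_scale \<iota> x h (monom_eval f w)"
proof -
  have "presentation \<iota> x f (y_monomial_term h w) =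
      (\<Sum>u\<in>Poly_Mapping.keys h. \<iota> (Poly_Mapping.lookup h u) * (monom_eval x u * monom_eval f w))"
    by (simp only: presentation_def y_monomial_term_def poly_eval_sum poly_eval_single
        monom_eval_case_sum x_part_join y_part_join)
  also have "\<dots> = S_scale \<iota> x h (monom_eval f w)"
    by (simp only: S_scale_def poly_eval_superset[OF finite_keys order_refl] sum_distrib_right mult.assoc)
  finally show ?thesis .
qed

text \<open>The map \<open>\<phi>\<close> sends \<open>h w\<close> to \<open>h \<phi>(w)\<close>, and it is linear over \<open>S\<close>. Spans in \<open>A\<close> thereby become conditions
  on the \<open>y\<close>-parts of a preimage in \<open>T\<close>, so that colon ideals in \<open>A\<close> can be read off from \<open>J\<close>.\<close>

lemma span_monom_eval:
  fixes x :: "'x::finite \<Rightarrow> 'a" and f :: "'y::finite \<Rightarrow> 'a"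
  shows "module.span (S_scale \<iota> x) (monom_eval f ` W) =
    presentation \<iota> x f ` {p. y_part ` Poly_Mapping.keys p \<subseteq> W}" (is "_ = ?R")
proof -
  interpret S: module "S_scale \<iota> x" by (rule module_S_scale)
  show ?thesis
  proof
    have "S.subspace ?R"
    proof (rule S.subspaceI)
      show "0 \<in> ?R"
        by (rule image_eqI[of _ _ 0]) (simp_all add: presentation_def poly_eval_zero)
      show "a + b \<in> ?R" if a: "a \<in> ?R" and b: "b \<in> ?R" for a b
      proof -
        obtain p q where pq: "a = presentation \<iota> x f p" "b = presentation \<iota> x f q"
          "y_part ` Poly_Mapping.keys p \<subseteq> W" "y_part ` Poly_Mapping.keys q \<subseteq> W"
          using a b by auto
        have "y_part ` Poly_Mapping.keys (p + q) \<subseteq> W"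
          using pq Poly_Mapping.keys_add[of p q] by blast
        then show ?thesis
          by (intro image_eqI[of _ _ "p + q"]) (auto simp: pq presentation_def poly_eval_add)
      qed
      show "S_scale \<iota> x h a \<in> ?R" if a: "a \<in> ?R" for h :: "('x, 'k) mpoly" and a
      proof -
        obtain p where p: "a = presentation \<iota> x f p" "y_part ` Poly_Mapping.keys p \<subseteq> W"
          using a by auto
        \<comment> \<open>This is \<open>h\<close> itself, regarded as an element of \<open>T\<close>.\<close>
        let ?h = "y_monomial_term h (0 :: 'y monom)"
        have "y_part t \<in> W" if t: "t \<in> Poly_Mapping.keys (?h * p)" for t
        proof -
          obtain r s where rs: "t = r + s" "r \<in> Poly_Mapping.keys ?h" "s \<in> Poly_Mapping.keys p"
            using subsetD[OF keys_mult t] by blast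
          then have "y_part r = 0"
            by (auto simp: in_keys_iff lookup_y_monomial_term split: if_splits)
          then show ?thesis using rs p by (auto simp: y_part_add)
        qed
        moreover have "S_scale \<iota> x h a = presentation \<iota> x f (?h * p)"
          using presentation_y_monomial_term[of x f h 0]
          by (simp add: p presentation_def poly_eval_mult S_scale_def monom_eval_def)
        ultimately show ?thesis by auto
      qed
    qed
    moreover have "monom_eval f w \<in> ?R" if "w \<in> W" for w
    proof (rule image_eqI)
      show "monom_eval f w = presentation \<iota> x f (y_monomial_term 1 w)"
        by (simp add: presentation_y_monomial_term)
      show "y_monomial_term 1 w \<in> {p. y_part ` Poly_Mapping.keys p \<subseteq> W}"
        using that by (auto simp: in_keys_iff lookup_y_monomial_term split: if_splits)
    qed
    ultimately show "S.span (monom_eval f ` W) \<subseteq> ?R"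
      by (intro S.span_minimal) auto
  next
    show "?R \<subseteq> S.span (monom_eval f ` W)"
    proof clarify
      fix p :: "('x + 'y, 'k) mpoly" assume p: "y_part ` Poly_Mapping.keys p \<subseteq> W"
      have "presentation \<iota> x f p =
          (\<Sum>w\<in>y_part ` Poly_Mapping.keys p. S_scale \<iota> x (y_coeff p w) (monom_eval f w))"
        unfolding presentation_y_monomial_term[symmetric]
        by (simp add: presentation_def poly_eval_sum[symmetric] y_expansion)
      also have "\<dots> \<in> S.span (monom_eval f ` W)"
        using p by (intro S.span_sum S.span_scale S.span_base) auto
      finally show "presentation \<iota> x f p \<in> S.span (monom_eval f ` W)" .
    qed
  qed
qed

end

section \<open>The bigrading of the presentation\<close>

text \<open>This is the bigrading of \<open>T\<close> with \<open>x\<^sub>i\<close> in degree \<open>(1, 0)\<close> and \<open>y\<^sub>j\<close> in degree \<open>(\<delta> j, 1)\<close>; the first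
  degree can be negative, since generators equal to zero may be given any degree.\<close>

definition bidegree :: "('y \<Rightarrow> int) \<Rightarrow> ('x::finite + 'y::finite) monom \<Rightarrow> int \<times> int" where
  "bidegree \<delta> t =
    (int (mdegree (x_part t)) + (\<Sum>j\<in>UNIV. int (Poly_Mapping.lookup (y_part t) j) * \<delta> j),
     int (mdegree (y_part t)))"

definition bigraded_component ::
  "('y \<Rightarrow> int) \<Rightarrow> int \<times> int \<Rightarrow> ('x::finite + 'y::finite, 'k::zero) mpoly \<Rightarrow> ('x + 'y, 'k) mpoly" where
  "bigraded_component \<delta> d p =
    Abs_poly_mapping (\<lambda>t. if bidegree \<delta> t = d then Poly_Mapping.lookup p t else 0)"

lemma lookup_bigraded_component:
  "Poly_Mapping.lookup (bigraded_component \<delta> d p) t =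
    (if bidegree \<delta> t = d then Poly_Mapping.lookup p t else 0)"
proof -
  have "finite {t. (if bidegree \<delta> t = d then Poly_Mapping.lookup p t else 0) \<noteq> 0}"
    by (rule finite_subset[OF _ finite_keys[of p]]) (auto simp: in_keys_iff split: if_splits)
  then show ?thesis by (simp add: bigraded_component_def)
qed

lemma keys_bigraded_component:
  "Poly_Mapping.keys (bigraded_component \<delta> d p) = {t \<in> Poly_Mapping.keys p. bidegree \<delta> t = d}"
  by (auto simp: in_keys_iff lookup_bigraded_component split: if_splits)

lemma sum_bigraded_components:
  fixes p :: "('x::finite + 'y::finite, 'k::comm_ring_1) mpoly"
  assumes "finite D" "bidegree \<delta> ` Poly_Mapping.keys p \<subseteq> D"
  shows "(\<Sum>d\<in>D. bigraded_component \<delta> d p) = p"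
proof (rule poly_mapping_eqI)
  fix t
  have "Poly_Mapping.lookup (\<Sum>d\<in>D. bigraded_component \<delta> d p) t =
      (if bidegree \<delta> t \<in> D then Poly_Mapping.lookup p t else 0)"
    using assms(1) by (simp add: lookup_sum lookup_bigraded_component)
  also have "\<dots> = Poly_Mapping.lookup p t"
  proof (cases "t \<in> Poly_Mapping.keys p")
    case True
    then have "bidegree \<delta> t \<in> D" using assms(2) by auto
    then show ?thesis by simp
  next
    case False
    then show ?thesis by (simp add: in_keys_iff)
  qed
  finally show "Poly_Mapping.lookup (\<Sum>d\<in>D. bigraded_component \<delta> d p) t = Poly_Mapping.lookup p t" .
qed

context bigraded_algebra
begin

lemma module_K: "module (\<lambda>c a. \<iota> c * a)"
  by (rule module.intro) (simp_all only: iota_add iota_mult iota_one distrib_left distrib_right mult.assoc mult_1)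

lemma component_0: "0 \<in> A d"
  using module.subspace_0[OF module_K component_subspace] .

lemma component_sum: "(\<And>i. i \<in> I \<Longrightarrow> b i \<in> A d) \<Longrightarrow> (\<Sum>i\<in>I. b i) \<in> A d"
  using module.subspace_sum[OF module_K component_subspace] .

lemma component_scale: "a \<in> A d \<Longrightarrow> \<iota> c * a \<in> A d"
  using module.subspace_scale[OF module_K component_subspace] .

lemma component_diff: "a \<in> A d \<Longrightarrow> b \<in> A d \<Longrightarrow> a - b \<in> A d"
  using module.subspace_diff[OF module_K component_subspace] .

lemma component_one: "1 \<in> A (0, 0)"
  unfolding component_zero using iota_one by (metis rangeI)

lemma component_power: "a \<in> A d \<Longrightarrow> a ^ n \<in> A (int n * fst d, int n * snd d)"
proof (induction n)
  case (Suc n)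
  then have "a * a ^ n \<in> A (d + (int n * fst d, int n * snd d))"
    by (intro component_mult) simp_all
  moreover have "d + (int n * fst d, int n * snd d) = (int (Suc n) * fst d, int (Suc n) * snd d)"
    by (simp add: prod_eq_iff algebra_simps)
  ultimately show ?case by simp
qed (simp add: component_one)

lemma component_monom_eval:
  fixes a :: "'v::finite \<Rightarrow> 'a"
  assumes "\<And>v. a v \<in> A (D v)"
  shows "monom_eval a t \<in> A (\<Sum>v\<in>UNIV. int (Poly_Mapping.lookup t v) * fst (D v),
    \<Sum>v\<in>UNIV. int (Poly_Mapping.lookup t v) * snd (D v))"
proof -
  have "(\<Prod>v\<in>V. a v ^ Poly_Mapping.lookup t v) \<in> A (\<Sum>v\<in>V. int (Poly_Mapping.lookup t v) * fst (D v),
      \<Sum>v\<in>V. int (Poly_Mapping.lookup t v) * snd (D v))" if "finite V" for V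
    using that
  proof (induction V)
    case (insert v V)
    then show ?case
      using component_mult[OF component_power[OF assms, of v "Poly_Mapping.lookup t v"] insert.IH] by simp
  qed (simp add: component_one)
  then show ?thesis by (simp add: monom_eval_UNIV)
qed

text \<open>Both the given family and the zero family decompose \<open>0\<close>, and such decompositions are unique.\<close>

lemma homogeneous_sum_eq_0:
  assumes "finite D" "\<And>d. d \<in> D \<Longrightarrow> b d \<in> A d" "(\<Sum>d\<in>D. b d) = 0" "d \<in> D"
  shows "b d = 0"
proof -
  define c where "c = Abs_poly_mapping (\<lambda>d. if d \<in> D then b d else 0)"
  have "finite {d. (if d \<in> D then b d else 0) \<noteq> 0}"
    by (rule finite_subset[OF _ assms(1)]) (auto split: if_splits)
  then have c: "Poly_Mapping.lookup c d = (if d \<in> D then b d else 0)" for d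
    by (simp add: c_def)
  have "(\<Sum>d\<in>Poly_Mapping.keys c. Poly_Mapping.lookup c d) = (\<Sum>d\<in>D. Poly_Mapping.lookup c d)"
    using assms(1) by (intro sum.mono_neutral_left) (auto simp: in_keys_iff c split: if_splits)
  then have "(\<forall>d. Poly_Mapping.lookup c d \<in> A d) \<and>
      0 = (\<Sum>d\<in>Poly_Mapping.keys c. Poly_Mapping.lookup c d)"
    using assms by (simp add: c component_0)
  moreover have "(\<forall>d. Poly_Mapping.lookup 0 d \<in> A d) \<and>
      0 = (\<Sum>d\<in>Poly_Mapping.keys (0 :: int \<times> int \<Rightarrow>\<^sub>0 'a). Poly_Mapping.lookup 0 d)"
    by (simp add: component_0)
  ultimately have "c = 0" using direct_sum[of 0] by blast
  then show ?thesis using c[of d] assms(4) by simp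
qed

end

context presented_bigraded_algebra
begin

lemma x_homogeneous: "x i \<in> A (1, 0)"
proof -
  let ?X = "Poly_Mapping.single (Poly_Mapping.single i 1) (1 :: 'k)"
  have "homogeneous 1 ?X" by (simp add: homogeneous_def mdegree_def)
  then have "poly_eval \<iota> x ?X \<in> A (1, 0)" unfolding part_zero_grading[symmetric] by simp
  then show ?thesis by (simp add: poly_eval_single monom_eval_def iota_one)
qed

lemma monom_eval_bidegree: "monom_eval (case_sum x f) t \<in> A (bidegree \<delta> t)"
proof -
  have "monom_eval x (x_part t) \<in> A (int (mdegree (x_part t)), 0)"
    using component_monom_eval[of x "\<lambda>_. (1, 0)" "x_part t"] x_homogeneous
    by (simp add: mdegree_sum_UNIV)
  moreover have "monom_eval f (y_part t) \<in>
      A (\<Sum>j\<in>UNIV. int (Poly_Mapping.lookup (y_part t) j) * \<delta> j, int (mdegree (y_part t)))"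
    using component_monom_eval[of f "\<lambda>j. (\<delta> j, 1)" "y_part t"] f_homogeneous
    by (simp add: mdegree_sum_UNIV)
  ultimately have "monom_eval x (x_part t) * monom_eval f (y_part t) \<in> A ((int (mdegree (x_part t)), 0) +
      (\<Sum>j\<in>UNIV. int (Poly_Mapping.lookup (y_part t) j) * \<delta> j, int (mdegree (y_part t))))"
    by (rule component_mult)
  then show ?thesis by (simp add: monom_eval_case_sum bidegree_def)
qed

lemma presentation_homogeneous:
  assumes "\<And>t. t \<in> Poly_Mapping.keys p \<Longrightarrow> bidegree \<delta> t = d"
  shows "presentation \<iota> x f p \<in> A d"
  unfolding presentation_def poly_eval_superset[OF finite_keys order_refl]
proof (intro component_sum component_scale)
  fix t assume "t \<in> Poly_Mapping.keys p"
  then show "monom_eval (case_sum x f) t \<in> A d"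
    using monom_eval_bidegree[of t] assms[of t] by simp
qed

lemma presentation_bigraded_component: "presentation \<iota> x f (bigraded_component \<delta> d p) \<in> A d"
  by (rule presentation_homogeneous) (simp add: keys_bigraded_component)

lemma presentation_sum_components:
  assumes "finite D" "bidegree \<delta> ` Poly_Mapping.keys p \<subseteq> D"
  shows "presentation \<iota> x f p = (\<Sum>d\<in>D. presentation \<iota> x f (bigraded_component \<delta> d p))"
  unfolding presentation_def poly_eval_sum[symmetric] sum_bigraded_components[OF assms] ..

text \<open>Since \<open>\<phi>\<close> respects the bigradings, \<open>\<phi>(p)\<close> is the sum of the homogeneous elements \<open>\<phi>(p\<^sub>e)\<close>. If it is
  itself homogeneous of bidegree \<open>d\<close>, comparing components leaves only \<open>\<phi>(p\<^sub>d)\<close>. The case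
  \<open>\<phi>(p) = 0\<close> says that \<open>J\<close> is bigraded.\<close>

lemma presentation_component_eq:
  assumes "presentation \<iota> x f p \<in> A d"
  shows "presentation \<iota> x f (bigraded_component \<delta> d p) = presentation \<iota> x f p"
proof -
  let ?\<phi> = "presentation \<iota> x f"
  \<comment> \<open>The bidegree \<open>d\<close> may fail to occur in \<open>p\<close>, so it is added by hand.\<close>
  define D where "D = insert d (bidegree \<delta> ` Poly_Mapping.keys p)"
  define b where "b e = ?\<phi> (bigraded_component \<delta> e p) - (if e = d then ?\<phi> p else 0)" for e
  have D: "finite D" "d \<in> D" by (simp_all add: D_def)
  have "(\<Sum>e\<in>D. b e) = (\<Sum>e\<in>D. ?\<phi> (bigraded_component \<delta> e p)) - ?\<phi> p"
    using D by (simp add: b_def sum_subtractf)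
  also have "\<dots> = 0"
    using presentation_sum_components[OF D(1), of p] by (simp add: D_def subset_insertI)
  finally have "b d = 0"
  proof (rule homogeneous_sum_eq_0[OF D(1), rotated])
    show "b e \<in> A e" for e
      unfolding b_def using assms
      by (intro component_diff presentation_bigraded_component) (simp add: component_0)
  qed (rule D(2))
  then show ?thesis by (simp add: b_def)
qed

lemma presentation_ideal_component:
  assumes "p \<in> presentation_ideal \<iota> x f"
  shows "bigraded_component \<delta> d p \<in> presentation_ideal \<iota> x f"
  using assms presentation_component_eq[of p d] component_0 by (simp add: presentation_ideal_def)

text \<open>The image of \<open>\<phi>\<close> is a subring; it contains \<open>A\<^sub>0\<close> through polynomials in the \<open>x\<^sub>i\<close> alone and \<open>A\<^sub>1\<close>
  through its generators \<open>f\<^sub>j = \<phi>(y\<^sub>j)\<close>, and these two generate \<open>A\<close>.\<close>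

lemma presentation_surj: "range (presentation \<iota> x f) = UNIV"
proof -
  let ?\<phi> = "presentation \<iota> x f"
  have "is_subring (range ?\<phi>)"
    unfolding is_subring_def
  proof (intro conjI ballI)
    show "1 \<in> range ?\<phi>"
      by (rule range_eqI[of _ _ 1]) (simp add: presentation_def poly_eval_one)
    show "a - b \<in> range ?\<phi>" if "a \<in> range ?\<phi>" "b \<in> range ?\<phi>" for a b
      using that by (auto simp: presentation_def poly_eval_diff[symmetric])
    show "a * b \<in> range ?\<phi>" if "a \<in> range ?\<phi>" "b \<in> range ?\<phi>" for a b
      using that by (auto simp: presentation_def poly_eval_mult[symmetric])
  qed
  moreover have "part 0 \<subseteq> range ?\<phi>"
  proof -
    have "poly_eval \<iota> x h = ?\<phi> (y_monomial_term h 0)" for h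
      by (simp add: presentation_y_monomial_term S_scale_def monom_eval_def)
    then have "range (poly_eval \<iota> x) \<subseteq> range ?\<phi>" by (simp add: image_subset_iff)
    then show ?thesis using part_zero_iso by (simp add: bij_betw_def)
  qed
  moreover have "part 1 \<subseteq> range ?\<phi>"
  proof -
    have "f j = monom_eval f (Poly_Mapping.single j 1)" for j by (simp add: monom_eval_def)
    then have "range f \<subseteq> monom_eval f ` UNIV" by auto
    then have "part 1 \<subseteq> module.span (S_scale \<iota> x) (monom_eval f ` UNIV)"
      unfolding f_generates[symmetric] by (rule module.span_mono[OF module_S_scale])
    then show ?thesis unfolding span_monom_eval by simp
  qed
  ultimately have "is_subring hull (part 0 \<union> part 1) \<subseteq> range ?\<phi>"
    by (intro hull_minimal) simp_all
  then show ?thesis using generated by (simp add: top.extremum_unique)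
qed

text \<open>Here \<open>A\<^sub>k = A\<^sub>1\<^sup>k\<close> enters: by surjectivity every element of \<open>A\<^sub>(\<^sub>i\<^sub>,\<^sub>k\<^sub>)\<close> has a preimage of bidegree
  \<open>(i, k)\<close>, all of whose monomials have \<open>y\<close>-degree \<open>k\<close>. Conversely the bihomogeneous components of
  a polynomial of \<open>y\<close>-degree \<open>k\<close> provide the decomposition of its image in \<open>A\<^sub>k\<close>.\<close>

lemma part_eq_span:
  "part (int k) = module.span (S_scale \<iota> x) (monom_eval f ` {w. mdegree w = k})"
proof -
  let ?\<phi> = "presentation \<iota> x f"
  have "?\<phi> p \<in> part (int k)" if p: "y_part ` Poly_Mapping.keys p \<subseteq> {w. mdegree w = k}" for p
  proof -
    define c where "c = Abs_poly_mapping (\<lambda>i. ?\<phi> (bigraded_component \<delta> (i, int k) p))"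
    define D where "D = fst ` bidegree \<delta> ` Poly_Mapping.keys p"
    have zero: "?\<phi> (bigraded_component \<delta> (i, int k) p) = 0" if "i \<notin> D" for i
    proof -
      have "Poly_Mapping.keys (bigraded_component \<delta> (i, int k) p) = {}"
        using that by (force simp: D_def keys_bigraded_component)
      then show ?thesis by (simp add: presentation_def poly_eval_zero)
    qed
    have D: "finite D" by (simp add: D_def)
    then have "finite {i. ?\<phi> (bigraded_component \<delta> (i, int k) p) \<noteq> 0}"
      by (rule finite_subset[rotated]) (use zero in auto)
    then have c: "Poly_Mapping.lookup c i = ?\<phi> (bigraded_component \<delta> (i, int k) p)" for i
      by (simp add: c_def)
    have "bidegree \<delta> ` Poly_Mapping.keys p \<subseteq> (\<lambda>i. (i, int k)) ` D"
    proof (rule image_subsetI)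
      fix t assume t: "t \<in> Poly_Mapping.keys p"
      then have "bidegree \<delta> t = (fst (bidegree \<delta> t), int k)"
        using p by (auto simp: bidegree_def)
      then show "bidegree \<delta> t \<in> (\<lambda>i. (i, int k)) ` D"
        using t unfolding D_def by (metis image_eqI)
    qed
    then have "?\<phi> p = (\<Sum>d\<in>(\<lambda>i. (i, int k)) ` D. ?\<phi> (bigraded_component \<delta> d p))"
      using D by (intro presentation_sum_components) simp_all
    also have "\<dots> = (\<Sum>i\<in>D. Poly_Mapping.lookup c i)"
      by (simp add: sum.reindex inj_on_def c)
    also have "\<dots> = (\<Sum>i\<in>Poly_Mapping.keys c. Poly_Mapping.lookup c i)"
    proof (rule sum.mono_neutral_right[OF D])
      show "Poly_Mapping.keys c \<subseteq> D" using zero c by (metis in_keys_iff subsetI)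
    qed (simp add: in_keys_iff)
    finally show ?thesis
      unfolding part_def graded_sum_def using c presentation_bigraded_component
      by (intro CollectI exI[of _ c]) simp
  qed
  moreover have "a \<in> module.span (S_scale \<iota> x) (monom_eval f ` {w. mdegree w = k})"
    if a: "a \<in> A (i, int k)" for a i
  proof -
    obtain p where p: "a = ?\<phi> p" using presentation_surj by (metis UNIV_I imageE)
    let ?q = "bigraded_component \<delta> (i, int k) p"
    have "a = ?\<phi> ?q" using presentation_component_eq[of p] a p by simp
    moreover have "y_part ` Poly_Mapping.keys ?q \<subseteq> {w. mdegree w = k}"
      by (auto simp: keys_bigraded_component bidegree_def)
    ultimately show ?thesis unfolding span_monom_eval by blast
  qed
  then have "part (int k) \<subseteq> module.span (S_scale \<iota> x) (monom_eval f ` {w. mdegree w = k})"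
    unfolding part_def graded_sum_def
    by (auto intro!: module.span_sum[OF module_S_scale])
  ultimately show ?thesis unfolding span_monom_eval by blast
qed

end

section \<open>Ideals with linear initial ideal\<close>

text \<open>The division algorithm. Subtracting from \<open>h\<close> a multiple of a linear form that cancels its leading
  term lowers the leading monomial. As the divisors are homogeneous, this does not raise the total
  degree; all leading monomials that occur lie in the finite set of monomials of degree at most
  \<open>D\<close>, so the process stops.\<close>

lemma linear_reduction:
  fixes I :: "('x::finite, 'k::field) mpoly set"
  assumes lt: "monomial_order lt"
    and I: "module.subspace (*) I"
    and divisor: "\<And>h. h \<in> I \<Longrightarrow> h \<noteq> 0 \<Longrightarrow> \<exists>l\<in>I. \<exists>u. l \<noteq> 0 \<and> homogeneous 1 l \<and>
      leading_monomial lt h = u + leading_monomial lt l"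
  shows "I = ideal_gen {l \<in> I. homogeneous 1 l}" (is "I = ideal_gen ?L")
proof
  show "ideal_gen ?L \<subseteq> I"
    by (rule ring_module.span_minimal) (use I in auto)
  show "I \<subseteq> ideal_gen ?L"
  proof
    fix h assume "h \<in> I"
    define D where "D = Max (mdegree ` Poly_Mapping.keys h)"
    have "\<forall>t\<in>Poly_Mapping.keys h. mdegree t \<le> D"
      by (simp add: D_def)
    then show "h \<in> ideal_gen ?L"
      using \<open>h \<in> I\<close>
    proof (induction "card {t. mdegree t \<le> D \<and> lt t (leading_monomial lt h)}" arbitrary: h
        rule: less_induct)
      case less
      show ?case
      proof (cases "h = 0")
        case True
        then show ?thesis using ring_module.span_zero by simp
      next
        case False
        let ?m = "leading_monomial lt h"
        obtain l u where l: "l \<in> I" "l \<noteq> 0" "homogeneous 1 l" "?m = u + leading_monomial lt l"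
          using divisor[OF less.prems(2) False] by blast
        let ?n = "leading_monomial lt l"
        have m: "?m \<in> Poly_Mapping.keys h" and n: "?n \<in> Poly_Mapping.keys l"
          using leading_monomial_in_keys[OF lt False] leading_monomial_in_keys[OF lt l(2)] by simp_all
        define c where "c = Poly_Mapping.lookup h ?m / Poly_Mapping.lookup l ?n"
        define q where "q = Poly_Mapping.single u c * l"
        define h' where "h' = h - q"
        have "q \<in> ideal_gen ?L"
          unfolding q_def using l by (intro ring_module.span_scale ring_module.span_base) simp
        have "c \<noteq> 0" using m n by (simp add: c_def in_keys_iff)
        then have q: "q \<noteq> 0" "leading_monomial lt q = ?m"
          using leading_monomial_single_mult[OF lt l(2), of c u] l(4) by (simp_all add: q_def)
        have "h' \<in> I"
          unfolding h'_def q_def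
          by (intro ring_module.subspace_diff[OF I] ring_module.subspace_scale[OF I] less.prems l)
        have keys_q: "mdegree t = mdegree ?m" if t: "t \<in> Poly_Mapping.keys q" for t
        proof -
          obtain s where "s \<in> Poly_Mapping.keys l" "t = u + s"
            using subsetD[OF keys_single_mult t[unfolded q_def]] by blast
          then show ?thesis using l(3,4) n by (simp add: homogeneous_def mdegree_add)
        qed
        have keys_h': "Poly_Mapping.keys h' \<subseteq> Poly_Mapping.keys h \<union> Poly_Mapping.keys q"
          unfolding h'_def by (auto simp: in_keys_iff lookup_minus)
        have deg: "\<forall>t\<in>Poly_Mapping.keys h'. mdegree t \<le> D"
        proof
          fix t assume "t \<in> Poly_Mapping.keys h'"
          then have "t \<in> Poly_Mapping.keys h \<or> mdegree t = mdegree ?m"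
            using keys_h' keys_q by auto
          then show "mdegree t \<le> D" using less.prems(1) m by auto
        qed
        have "h' \<in> ideal_gen ?L"
        proof (cases "h' = 0")
          case True
          then show ?thesis using ring_module.span_zero by simp
        next
          case False
          let ?m' = "leading_monomial lt h'"
          have m': "?m' \<in> Poly_Mapping.keys h'" using leading_monomial_in_keys[OF lt False] .
          have "Poly_Mapping.lookup h' ?m = 0"
            using n lookup_single_mult[of u c l ?n]
            by (simp add: h'_def q_def l(4) lookup_minus c_def in_keys_iff)
          then have "?m' \<noteq> ?m" using m' by (auto simp: in_keys_iff)
          then have "lt ?m' ?m"
            using m' keys_h' leading_monomial_greatest[OF lt \<open>h \<noteq> 0\<close>, of ?m']
              leading_monomial_greatest[OF lt q(1), of ?m'] q(2) by auto
          then have "?m' \<in> {t. mdegree t \<le> D \<and> lt t ?m}" "?m' \<notin> {t. mdegree t \<le> D \<and> lt t ?m'}"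
            using m' deg monomial_order_irrefl[OF lt, of ?m'] by simp_all
          moreover have "{t. mdegree t \<le> D \<and> lt t ?m'} \<subseteq> {t. mdegree t \<le> D \<and> lt t ?m}"
            using \<open>lt ?m' ?m\<close> monomial_order_trans[OF lt, of _ ?m' ?m] by blast
          ultimately have "{t. mdegree t \<le> D \<and> lt t ?m'} \<subset> {t. mdegree t \<le> D \<and> lt t ?m}"
            by blast
          then have "card {t. mdegree t \<le> D \<and> lt t ?m'} < card {t. mdegree t \<le> D \<and> lt t ?m}"
            by (intro psubset_card_mono finite_subset[OF _ finite_mdegree_le[of D]]) auto
          then show ?thesis using less.hyps deg \<open>h' \<in> I\<close> by blast
        qed
        then have "h' + q \<in> ideal_gen ?L"
          using \<open>q \<in> ideal_gen ?L\<close> by (rule ring_module.span_add)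
        then show ?thesis by (simp add: h'_def)
      qed
    qed
  qed
qed

lemma ideal_eq_UNIV_if_constant:
  fixes I :: "('x::finite, 'k::field) mpoly set"
  assumes I: "module.subspace (*) I" and l: "l \<in> I" "l \<noteq> 0" "homogeneous 0 l"
  shows "I = UNIV"
proof -
  have keys: "Poly_Mapping.keys l \<subseteq> {0}"
    using l(3) by (auto simp: homogeneous_def mdegree_eq_0_iff)
  define c where "c = Poly_Mapping.lookup l 0"
  have "l = Poly_Mapping.single 0 c"
    using keys by (intro poly_mapping_eqI) (auto simp: c_def lookup_single when_def in_keys_iff)
  moreover from this have "c \<noteq> 0" using l(2) by auto
  ultimately have "Poly_Mapping.single 0 (1 / c) * l = 1"
    by (simp add: mult_single)
  then have "1 \<in> I" using ring_module.subspace_scale[OF I l(1), of "Poly_Mapping.single 0 (1 / c)"] by simp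
  then have "h * 1 \<in> I" for h using ring_module.subspace_scale[OF I] by blast
  then show ?thesis by auto
qed

text \<open>The hypothesis says that \<open>I\<close> has a Groebner basis of forms of degree at most one.\<close>

lemma ideal_UNIV_or_linear:
  fixes I :: "('x::finite, 'k::field) mpoly set"
  assumes lt: "monomial_order lt"
    and I: "module.subspace (*) I"
    and divisor: "\<And>h. h \<in> I \<Longrightarrow> h \<noteq> 0 \<Longrightarrow> \<exists>l\<in>I. \<exists>u. l \<noteq> 0 \<and>
      homogeneous (int (mdegree (leading_monomial lt l))) l \<and> mdegree (leading_monomial lt l) \<le> 1 \<and>
      leading_monomial lt h = u + leading_monomial lt l"
  shows "I = UNIV \<or> (\<exists>L. (\<forall>l\<in>L. homogeneous 1 l) \<and> I = ideal_gen L)"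
proof (cases "\<exists>l\<in>I. l \<noteq> 0 \<and> homogeneous 0 l")
  case True
  then obtain l where "l \<in> I" "l \<noteq> 0" "homogeneous 0 l" by blast
  then have "I = UNIV" by (rule ideal_eq_UNIV_if_constant[OF I])
  then show ?thesis ..
next
  case False
  have "I = ideal_gen {l \<in> I. homogeneous 1 l}"
  proof (rule linear_reduction[OF lt I])
    fix h assume h: "h \<in> I" "h \<noteq> 0"
    obtain l u where l: "l \<in> I" "l \<noteq> 0"
      "homogeneous (int (mdegree (leading_monomial lt l))) l" "mdegree (leading_monomial lt l) \<le> 1"
      "leading_monomial lt h = u + leading_monomial lt l" using divisor[OF h] by blast
    have "mdegree (leading_monomial lt l) \<noteq> 0"
    proof
      assume "mdegree (leading_monomial lt l) = 0"
      then have "homogeneous 0 l" using l(3) by simp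
      then show False using False l(1,2) by blast
    qed
    then have "mdegree (leading_monomial lt l) = 1" using l(4) by simp
    then have "homogeneous 1 l" using l(3) by simp
    with l show "\<exists>l\<in>I. \<exists>u. l \<noteq> 0 \<and> homogeneous 1 l \<and>
        leading_monomial lt h = u + leading_monomial lt l"
      by (intro bexI[of _ l] exI[of _ u] conjI)
  qed
  then show ?thesis
    by (intro disjI2 exI[of _ "{l \<in> I. homogeneous 1 l}"] conjI) simp_all
qed

section \<open>The colon ideals\<close>

context bigraded_algebra
begin

text \<open>A relation \<open>h \<phi>(w) = \<phi>(q)\<close>, where the \<open>y\<close>-parts of \<open>q\<close> lie in \<open>W\<close>, is the same as the element
  \<open>p = h w - q\<close> of \<open>J\<close>. The condition \<open>w \<notin> W\<close> makes \<open>h\<close> the full coefficient of \<open>w\<close> in \<open>p\<close>.\<close>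

lemma colon_iff:
  fixes x :: "'x::finite \<Rightarrow> 'a" and f :: "'y::finite \<Rightarrow> 'a"
  assumes "w \<notin> W"
  shows "S_scale \<iota> x h (monom_eval f w) \<in> module.span (S_scale \<iota> x) (monom_eval f ` W) \<longleftrightarrow>
    (\<exists>p\<in>presentation_ideal \<iota> x f. y_coeff p w = h \<and> y_part ` Poly_Mapping.keys p \<subseteq> insert w W)"
    (is "?l \<longleftrightarrow> ?r")
proof
  assume ?l
  then obtain q where q: "S_scale \<iota> x h (monom_eval f w) = presentation \<iota> x f q"
    "y_part ` Poly_Mapping.keys q \<subseteq> W"
    unfolding span_monom_eval by blast
  let ?p = "y_monomial_term h w - q"
  have "Poly_Mapping.lookup q (join_monom u w) = 0" for u
    using assms q(2) by (metis image_subset_iff in_keys_iff y_part_join)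
  then have "y_coeff ?p w = h"
    by (intro poly_mapping_eqI) (simp add: lookup_y_coeff lookup_minus lookup_y_monomial_term)
  moreover have "y_part ` Poly_Mapping.keys ?p \<subseteq> insert w W"
  proof clarify
    fix t assume t: "t \<in> Poly_Mapping.keys ?p" "y_part t \<notin> W"
    then have "t \<notin> Poly_Mapping.keys q" using q(2) by auto
    then show "y_part t = w"
      using t(1) by (auto simp: in_keys_iff lookup_minus lookup_y_monomial_term split: if_splits)
  qed
  moreover have "?p \<in> presentation_ideal \<iota> x f"
    using q(1) by (simp add: presentation_ideal_def presentation_y_monomial_term[symmetric]
        presentation_def poly_eval_diff)
  ultimately show ?r by blast
next
  assume ?r
  then obtain p where p: "p \<in> presentation_ideal \<iota> x f" "y_coeff p w = h"
    "y_part ` Poly_Mapping.keys p \<subseteq> insert w W" by blast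
  let ?q = "y_monomial_term h w - p"
  have zero_w: "Poly_Mapping.lookup ?q t = 0" if "y_part t = w" for t
    using that by (simp add: lookup_minus lookup_y_monomial_term lookup_y_coeff p(2)[symmetric])
      (metis join_monom_parts right_minus_eq)
  have zero_out: "Poly_Mapping.lookup ?q t = 0" if "y_part t \<notin> insert w W" for t
  proof -
    have "t \<notin> Poly_Mapping.keys p" using that p(3) by auto
    then show ?thesis using that by (simp add: lookup_minus lookup_y_monomial_term in_keys_iff)
  qed
  have "y_part ` Poly_Mapping.keys ?q \<subseteq> W"
  proof (rule image_subsetI)
    fix t assume "t \<in> Poly_Mapping.keys ?q"
    then have "Poly_Mapping.lookup ?q t \<noteq> 0" by (simp only: in_keys_iff not_False_eq_True)
    then show "y_part t \<in> W" using zero_w[of t] zero_out[of t] by blast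
  qed
  moreover have "S_scale \<iota> x h (monom_eval f w) = presentation \<iota> x f ?q"
    using p(1) by (simp add: presentation_ideal_def presentation_y_monomial_term[symmetric]
        presentation_def poly_eval_diff)
  ultimately show ?l unfolding span_monom_eval by blast
qed

lemma subspace_presentation_ideal:
  fixes x :: "'x::finite \<Rightarrow> 'a" and f :: "'y::finite \<Rightarrow> 'a"
  shows "module.subspace (*) (presentation_ideal \<iota> x f)"
  by (rule ring_module.subspaceI)
    (simp_all add: presentation_ideal_def presentation_def poly_eval_zero poly_eval_add poly_eval_mult)

end

context presented_bigraded_algebra
begin

text \<open>This is where the \<open>x\<close>-condition and the shape of the product order are used. An element \<open>h\<close> of the
  colon ideal lifts to \<open>p \<in> J\<close> with leading monomial \<open>u w\<close>, where \<open>u\<close> is the leading monomial of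
  \<open>h\<close>; a minimal generator of the initial ideal dividing \<open>u w\<close> supplies a form \<open>l\<close> in the colon
  ideal of degree at most one whose leading monomial divides \<open>u\<close>.\<close>

lemma colon_divisor:
  fixes lt_y :: "'y monom \<Rightarrow> 'y monom \<Rightarrow> bool" and lt_x :: "'x monom \<Rightarrow> 'x monom \<Rightarrow> bool"
  assumes lt_y: "monomial_order lt_y" and lt_x: "monomial_order lt_x"
    and x_cond: "x_condition (product_order lt_y lt_x) (presentation_ideal \<iota> x f)"
    and W: "W = {w'. mdegree w' = mdegree w \<and> lt_y w' w}"
    and I: "I = {h. S_scale \<iota> x h (monom_eval f w) \<in> module.span (S_scale \<iota> x) (monom_eval f ` W)}"
    and h: "h \<in> I" "h \<noteq> 0"
  shows "\<exists>l\<in>I. \<exists>u. l \<noteq> 0 \<and>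
    homogeneous (int (mdegree (leading_monomial lt_x l))) l \<and> mdegree (leading_monomial lt_x l) \<le> 1 \<and>
    leading_monomial lt_x h = u + leading_monomial lt_x l"
proof -
  let ?lt = "product_order lt_y lt_x" and ?J = "presentation_ideal \<iota> x f"
  note lt = monomial_order_product_order[OF lt_y lt_x]
  note initial = monomial_in_initial_ideal_iff[OF lt subspace_presentation_ideal]
  have "w \<notin> W" using monomial_order_irrefl[OF lt_y] by (simp add: W)
  note colon = colon_iff[OF this]
  let ?m = "leading_monomial lt_x h"

  obtain p where p: "p \<in> ?J" "y_coeff p w = h" "y_part ` Poly_Mapping.keys p \<subseteq> insert w W"
    using h(1) colon unfolding I by blast
  have m: "?m \<in> Poly_Mapping.keys h" by (rule leading_monomial_in_keys[OF lt_x h(2)])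
  then have m_in: "join_monom ?m w \<in> Poly_Mapping.keys p"
    unfolding p(2)[symmetric] by (simp add: in_keys_iff lookup_y_coeff)
  have "leading_monomial ?lt p = join_monom ?m w"
  proof (rule leading_monomial_eqI[OF lt m_in])
    fix s assume s: "s \<in> Poly_Mapping.keys p" "s \<noteq> join_monom ?m w"
    show "?lt s (join_monom ?m w)"
    proof (cases "y_part s = w")
      case True
      then have "s = join_monom (x_part s) w" by (metis join_monom_parts)
      then have "x_part s \<in> Poly_Mapping.keys h" "x_part s \<noteq> ?m"
        using s p(2)[symmetric] by (auto simp: in_keys_iff lookup_y_coeff)
      then show ?thesis
        using leading_monomial_greatest[OF lt_x h(2)] True by (simp add: product_order_def)
    next
      case False
      then show ?thesis using s p(3) W by (auto simp: product_order_def)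
    qed
  qed
  then have "Poly_Mapping.single (join_monom ?m w) 1 \<in> initial_ideal ?lt ?J"
    unfolding initial using p(1) m_in by (intro bexI[of _ p]) auto
  then obtain g r where g: "join_monom ?m w = g + r" "g \<in> minimal_monomial_generators (initial_ideal ?lt ?J)"
    using ex_minimal_monomial_generator by blast
  let ?v = "x_part g"
  have v: "mdegree ?v \<le> 1" "?m = ?v + x_part r" "w = y_part g + y_part r"
    using x_cond g(2) arg_cong[OF g(1), of x_part] arg_cong[OF g(1), of y_part]
    by (auto simp: x_condition_def x_part_add y_part_add)
  obtain q where q: "q \<in> ?J" "q \<noteq> 0" "leading_monomial ?lt q = g"
    using g(2) initial by (auto simp: minimal_monomial_generators_def)

  \<comment> \<open>Multiplying by a monomial in the \<open>y\<^sub>j\<close> restores the full \<open>y\<close>-part \<open>w\<close> and keeps the \<open>x\<close>-part \<open>v\<close>.\<close>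
  define n where "n = join_monom ?v w"
  define p' where "p' = Poly_Mapping.single (join_monom 0 (y_part r)) 1 * q"
  have p': "p' \<in> ?J" "p' \<noteq> 0" "leading_monomial ?lt p' = n"
  proof -
    show "p' \<in> ?J" unfolding p'_def
      by (rule ring_module.subspace_scale[OF subspace_presentation_ideal q(1)])
    have "join_monom 0 (y_part r) + g = n"
      by (rule monom_eqI) (simp_all add: n_def x_part_add y_part_add v(3) add.commute)
    then show "p' \<noteq> 0" "leading_monomial ?lt p' = n"
      using leading_monomial_single_mult[OF lt q(2), of 1 "join_monom 0 (y_part r)"] q(3)
      by (simp_all add: p'_def)
  qed
  \<comment> \<open>The order on \<open>K[y]\<close> need not be compatible with degrees, so \<open>p'\<close> may involve smaller monomials
    of other \<open>y\<close>-degrees. Passing to the component of the leading monomial removes them, and it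
    makes the coefficient of \<open>w\<close> homogeneous.\<close>
  define p'' where "p'' = bigraded_component \<delta> (bidegree \<delta> n) p'"
  define l where "l = y_coeff p'' w"
  have p''_J: "p'' \<in> ?J"
    unfolding p''_def by (rule presentation_ideal_component[OF p'(1)])
  have keys_p'': "Poly_Mapping.keys p'' = {t \<in> Poly_Mapping.keys p'. bidegree \<delta> t = bidegree \<delta> n}"
    unfolding p''_def by (rule keys_bigraded_component)
  have le_n: "t = n \<or> ?lt t n" if "t \<in> Poly_Mapping.keys p''" for t
    using that keys_p'' leading_monomial_greatest[OF lt p'(2)] p'(3) by auto
  have "n \<in> Poly_Mapping.keys p''"
    using keys_p'' leading_monomial_in_keys[OF lt p'(2)] p'(3) by simp
  then have v_in: "?v \<in> Poly_Mapping.keys l"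
    by (simp add: l_def in_keys_iff lookup_y_coeff n_def)
  have keys_l: "join_monom u w \<in> Poly_Mapping.keys p''" if "u \<in> Poly_Mapping.keys l" for u
    using that by (simp add: l_def in_keys_iff lookup_y_coeff)
  have lm_l: "leading_monomial lt_x l = ?v"
  proof (rule leading_monomial_eqI[OF lt_x v_in])
    fix u assume "u \<in> Poly_Mapping.keys l" "u \<noteq> ?v"
    then have "join_monom u w = n \<or> ?lt (join_monom u w) n" "join_monom u w \<noteq> n"
      using le_n[OF keys_l] by (auto simp: n_def dest: arg_cong[of _ _ x_part])
    then show "lt_x u ?v"
      using monomial_order_irrefl[OF lt_y] by (simp add: n_def product_order_def)
  qed
  have "y_part ` Poly_Mapping.keys p'' \<subseteq> insert w W"
  proof clarify
    fix t assume t: "t \<in> Poly_Mapping.keys p''" "y_part t \<notin> W"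
    have "mdegree (y_part t) = mdegree w"
      using t(1) keys_p'' by (simp add: bidegree_def n_def)
    then show "y_part t = w"
      using le_n[OF t(1)] t(2) by (auto simp: W n_def product_order_def)
  qed
  then have "l \<in> I" using p''_J colon[of x l f] unfolding I l_def by blast
  moreover have "l \<noteq> 0" using v_in by auto
  moreover have "homogeneous (int (mdegree ?v)) l"
    unfolding homogeneous_def using keys_l keys_p'' by (auto simp: bidegree_def n_def)
  moreover have "?m = x_part r + ?v" by (simp add: v(2) add.commute)
  ultimately show ?thesis using v(1) lm_l by auto
qed

end

section \<open>Linear quotients\<close>

theorem theorem2p3:
  fixes \<iota> :: "'k::field \<Rightarrow> 'a::comm_ring_1"
    and A :: "int \<times> int \<Rightarrow> 'a set"
    and x :: "'x::finite \<Rightarrow> 'a"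
    and f :: "'y::finite \<Rightarrow> 'a"
    and \<delta> :: "'y \<Rightarrow> int"
    and lt_y :: "'y monom \<Rightarrow> 'y monom \<Rightarrow> bool"
    and lt_x :: "'x monom \<Rightarrow> 'x monom \<Rightarrow> bool"
  assumes "presented_bigraded_algebra \<iota> A x f \<delta>"
    and "monomial_order lt_y"
    and "monomial_order lt_x"
    and "x_condition (product_order lt_y lt_x) (presentation_ideal \<iota> x f)"
  shows "\<forall>k::int. k \<ge> 1 \<longrightarrow> has_linear_quotients (S_scale \<iota> x) (bigraded_algebra.part A k)"
proof (intro allI impI)
  fix k :: int assume "k \<ge> 1"
  interpret presented_bigraded_algebra \<iota> A x f \<delta> by (rule assms(1))
  interpret S: module "S_scale \<iota> x" by (rule module_S_scale)
  define K where "K = nat k"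
  have k: "k = int K" using \<open>k \<ge> 1\<close> by (simp add: K_def)
  have "finite {w :: 'y monom. mdegree w = K}"
    by (rule finite_subset[OF _ finite_mdegree_le[of K]]) auto
  then obtain ws where ws: "set ws = {w :: 'y monom. mdegree w = K}" "sorted_wrt lt_y ws"
    using monomial_order_sorted_list[OF assms(2)] by blast
  show "has_linear_quotients (S_scale \<iota> x) (part k)"
    unfolding has_linear_quotients_def
  proof (intro exI[of _ "map (monom_eval f) ws"] conjI allI impI)
    show "S.span (set (map (monom_eval f) ws)) = part k"
      by (simp add: ws(1) part_eq_span k)
    fix j assume "j < length (map (monom_eval f) ws)"
    then have j: "j < length ws" by simp
    define w where "w = ws ! j"
    have w: "mdegree w = K" using j ws(1) nth_mem[OF j] by (simp add: w_def)
    define W where "W = {w'. mdegree w' = mdegree w \<and> lt_y w' w}"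
    define I where "I = {h. S_scale \<iota> x h (monom_eval f w) \<in> S.span (monom_eval f ` W)}"
    \<comment> \<open>As the list is increasing, the generators before \<open>g\<^sub>j\<close> come from the monomials below \<open>w\<^sub>j\<close>.\<close>
    have "set (take j ws) = W"
    proof (intro set_eqI iffI)
      fix w' assume "w' \<in> set (take j ws)"
      then obtain i where "i < j" "w' = ws ! i" using j by (auto simp: in_set_conv_nth)
      then show "w' \<in> W"
        using j ws w sorted_wrt_nth_less[OF ws(2), of i j] nth_mem[of i ws] by (simp add: W_def w_def)
    next
      fix w' assume w': "w' \<in> W"
      then have "w' \<in> set ws" using w ws(1) by (simp add: W_def)
      then obtain i where i: "i < length ws" "w' = ws ! i" by (auto simp: in_set_conv_nth)
      have "lt_y w' w" using w' by (simp add: W_def)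
      then have "i < j"
        using i j sorted_wrt_nth_less[OF ws(2), of j i] monomial_order_trans[OF assms(2), of w' w w']
          monomial_order_irrefl[OF assms(2), of w'] by (cases i j rule: linorder_cases) (auto simp: w_def)
      then show "w' \<in> set (take j ws)" using i j by (auto simp: in_set_conv_nth)
    qed
    then have I_eq: "{h. S_scale \<iota> x h (map (monom_eval f) ws ! j) \<in>
        S.span (set (take j (map (monom_eval f) ws)))} = I"
      using j by (simp add: I_def w_def take_map)
    have "ring_module.subspace I"
      by (rule ring_module.subspaceI)
        (simp_all add: I_def S.scale_left_distrib S.span_add S.span_zero S.span_scale S.scale_scale[symmetric]
          del: S.scale_scale)
    then have "I = UNIV \<or> (\<exists>L. (\<forall>l\<in>L. homogeneous 1 l) \<and> I = ideal_gen L)"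
      using colon_divisor[OF assms(2-4) W_def I_def] by (rule ideal_UNIV_or_linear[OF assms(3)])
    then show "let I = {h. S_scale \<iota> x h (map (monom_eval f) ws ! j) \<in>
          S.span (set (take j (map (monom_eval f) ws)))}
        in I = UNIV \<or> (\<exists>L. (\<forall>l\<in>L. homogeneous 1 l) \<and> I = ideal_gen L)"
      unfolding I_eq Let_def .
  qed
qed

end
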